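(* (i) Let $A,B$ be Banach algebras. Every generalised homomorphism $T:A\to B$ is a generalised triple homomorphism when $A$ and $B$ are both equipped with the triple product $\{a,b,c\}=\frac12(abc+cba)$. (ii) Let $A,B$ be Banach $^*$-algebras and let $T:A\to B$ be a generalised $^*$-homomorphism. Then $T$ is a generalised triple homomorphism when $A$ and $B$ are both equipped with the triple product $\{a,b,c\}=\frac12(ab^*c+cb^*a)$.
   Context: A linear mapping $T:A\to B$ between Banach algebras is not assumed continuous. It is a generalised homomorphism if the bilinear mapping $(a,b)\mapsto T(ab)-T(a)T(b)$ is continuous, i.e. there is $\varepsilon>0$ with $\|T(ab)-T(a)T(b)\|\le\varepsilon\|a\|\|b\|$ for all $a,b\in A$. A Banach $^*$-algebra is a Banach algebra with a continuous (conjugate-linear) algebra involution $^*$. A linear mapping $T:A\to B$ between Banach $^*$-algebras is a generalised $^*$-homomorphism if it is a generalised homomorphism and the mapping $a\mapsto T(a^* )^*-T(a)$ is continuous. A linear mapping $T:E\to F$ between Banach spaces equipped with triple products $\{\cdot,\cdot,\cdot\}$ is a generalised triple homomorphism if $(a,b,c)\mapsto T(\{a,b,c\})-\{T(a),T(b),T(c)\}$ is jointly continuous, i.e. there is $C>0$ with $\|T(\{a,b,c\})-\{T(a),T(b),T(c)\}\|\le C\|a\|\|b\|\|c\|$ for all $a,b,c\in E$. *)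

theory Defs
  imports "HOL-Analysis.Analysis"
begin

text \<open>
  Real and complex scalars are treated uniformly. By Gelfand--Mazur a \<^class>\<open>real_normed_field\<close>
  is isomorphic to the reals or the complex numbers, and the last axiom below forces
  the conjugation to be the usual one (the identity on the reals).
\<close>

class real_or_complex = real_normed_field +
  fixes conjugate :: "'a \<Rightarrow> 'a"
  assumes conjugate_add: "conjugate (x + y) = conjugate x + conjugate y"
    and conjugate_mult: "conjugate (x * y) = conjugate x * conjugate y"
    and conjugate_conjugate: "conjugate (conjugate x) = x"
    and mult_conjugate: "x * conjugate x = (norm x)\<^sup>2 *\<^sub>R 1"

instantiation real :: real_or_complex
begin
definition conjugate_real :: "real \<Rightarrow> real" where "conjugate_real x = x"
instance
  by standard (simp_all add: conjugate_real_def power2_eq_square)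
end

instantiation complex :: real_or_complex
begin
definition conjugate_complex :: "complex \<Rightarrow> complex" where "conjugate_complex = cnj"
instance
  by standard (simp_all add: conjugate_complex_def complex_norm_square[symmetric] scaleR_conv_of_real del: of_real_power)
end

text \<open>
  The type classes supply completeness, the (possibly non-unital) ring structure and the
  submultiplicative norm; the locale adds the action of the scalar field.
\<close>

locale banach_algebra = vector_space scale
  for scale :: "'k::real_or_complex \<Rightarrow> 'a::{real_normed_algebra,banach} \<Rightarrow> 'a" +
  assumes scale_of_real: "scale (of_real r) x = r *\<^sub>R x"
    and norm_scale: "norm (scale k x) = norm k * norm x"
    and mult_scale_left: "scale k x * y = scale k (x * y)"
    and mult_scale_right: "x * scale k y = scale k (x * y)"

locale banach_star_algebra = banach_algebra scale
  for scale :: "'k::real_or_complex \<Rightarrow> 'a::{real_normed_algebra,banach} \<Rightarrow> 'a" +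
  fixes star :: "'a \<Rightarrow> 'a"
  assumes star_add: "star (x + y) = star x + star y"
    and star_scale: "star (scale k x) = scale (conjugate k) (star x)"
    and star_mult: "star (x * y) = star y * star x"
    and star_star: "star (star x) = x"
    and continuous_star: "continuous_on UNIV star"

definition generalised_hom ::
  "('k::real_or_complex \<Rightarrow> 'a::{real_normed_algebra,banach} \<Rightarrow> 'a) \<Rightarrow>
   ('k \<Rightarrow> 'b::{real_normed_algebra,banach} \<Rightarrow> 'b) \<Rightarrow> ('a \<Rightarrow> 'b) \<Rightarrow> bool" where
  "generalised_hom scaleA scaleB T \<longleftrightarrow>
     Vector_Spaces.linear scaleA scaleB T \<and>
     (\<exists>\<epsilon>>0. \<forall>a b. norm (T (a * b) - T a * T b) \<le> \<epsilon> * norm a * norm b)"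

definition generalised_star_hom ::
  "('k::real_or_complex \<Rightarrow> 'a::{real_normed_algebra,banach} \<Rightarrow> 'a) \<Rightarrow> ('a \<Rightarrow> 'a) \<Rightarrow>
   ('k \<Rightarrow> 'b::{real_normed_algebra,banach} \<Rightarrow> 'b) \<Rightarrow> ('b \<Rightarrow> 'b) \<Rightarrow> ('a \<Rightarrow> 'b) \<Rightarrow> bool" where
  "generalised_star_hom scaleA starA scaleB starB T \<longleftrightarrow>
     generalised_hom scaleA scaleB T \<and>
     continuous_on UNIV (\<lambda>a. starB (T (starA a)) - T a)"

definition generalised_triple_hom ::
  "('k::real_or_complex \<Rightarrow> 'e::banach \<Rightarrow> 'e) \<Rightarrow> ('e \<Rightarrow> 'e \<Rightarrow> 'e \<Rightarrow> 'e) \<Rightarrow>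
   ('k \<Rightarrow> 'f::banach \<Rightarrow> 'f) \<Rightarrow> ('f \<Rightarrow> 'f \<Rightarrow> 'f \<Rightarrow> 'f) \<Rightarrow> ('e \<Rightarrow> 'f) \<Rightarrow> bool" where
  "generalised_triple_hom scaleE tripleE scaleF tripleF T \<longleftrightarrow>
     Vector_Spaces.linear scaleE scaleF T \<and>
     (\<exists>C>0. \<forall>a b c. norm (T (tripleE a b c) - tripleF (T a) (T b) (T c))
                     \<le> C * norm a * norm b * norm c)"

definition algebra_triple :: "'a::real_normed_algebra \<Rightarrow> 'a \<Rightarrow> 'a \<Rightarrow> 'a" where
  "algebra_triple a b c = (1 / 2) *\<^sub>R (a * b * c + c * b * a)"

definition star_triple ::
  "('a::real_normed_algebra \<Rightarrow> 'a) \<Rightarrow> 'a \<Rightarrow> 'a \<Rightarrow> 'a \<Rightarrow> 'a" where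
  "star_triple star a b c = (1 / 2) *\<^sub>R (a * star b * c + c * star b * a)"

end

theory Submission
  imports Defs
begin

text \<open>
  Write \<open>\<beta>(a,b) = T(ab) - T(a)T(b)\<close>. Modulo the bounded term \<open>\<beta>(ab,c)\<close>, the defect of \<open>T\<close> on \<open>abc\<close>
  is \<open>\<beta>(a,b)T(c)\<close>. The cocycle identity
  \<open>T(a)\<beta>(b,c) - \<beta>(ab,c) + \<beta>(a,bc) - \<beta>(a,b)T(c) = 0\<close> shows that \<open>\<beta>(a,b)T(c)\<close> is continuous in \<open>c\<close> for
  fixed \<open>a, b\<close>; as it is clearly bounded in \<open>(a,b)\<close> for fixed \<open>c\<close>, the uniform boundedness principle
  makes it jointly continuous.

  In the involutive case put \<open>E(b) = T(b) - T(b\<^sup>*)\<^sup>*\<close>, which is continuous. The new term to control is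
  \<open>T(a)E(b\<^sup>*)T(c)\<close>. Expanding \<open>E(ab)\<close> shows that \<open>T(a)E(b) + E(a)T(b)\<close> is bounded, so the same
  separate-to-joint continuity argument applies first to \<open>T(a)E(b)\<close>, hence to \<open>E(a)T(b)\<close>, and then
  to \<open>T(a)E(b)T(c)\<close>.
\<close>

section \<open>Uniform boundedness\<close>

lemma linear_norm_bound:
  fixes f :: "'a::real_normed_vector \<Rightarrow> 'b::real_normed_vector"
  assumes "linear f" and "r > 0" and bound: "\<And>x. norm x \<le> r \<Longrightarrow> norm (f x) \<le> K"
  shows "norm (f x) \<le> K / r * norm x"
proof (cases "x = 0")
  case True
  then show ?thesis
    using linear_0[OF \<open>linear f\<close>] by simp
next
  case False
  let ?t = "r / norm x"
  have "norm (f (?t *\<^sub>R x)) \<le> K"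
    using False \<open>r > 0\<close> by (intro bound) simp
  then have "?t * norm (f x) \<le> K"
    using \<open>r > 0\<close> by (simp add: linear_cmul[OF \<open>linear f\<close>])
  then show ?thesis
    using False \<open>r > 0\<close> by (simp add: field_simps)
qed

lemma bounded_linear_if_continuous:
  fixes f :: "'a::real_normed_vector \<Rightarrow> 'b::real_normed_vector"
  assumes "linear f" and "continuous_on UNIV f"
  shows "bounded_linear f"
proof -
  have "isCont f 0"
    using assms(2) by (simp add: continuous_on_eq_continuous_at)
  then obtain d where d: "d > 0" "\<And>x. dist x 0 < d \<Longrightarrow> dist (f x) (f 0) < 1"
    unfolding continuous_at_eps_delta by (metis zero_less_one)
  \<comment> \<open>Halving \<open>d\<close> fits a closed ball inside the open one that continuity
    supplies.\<close>
  have "norm (f x) \<le> 1" if "norm x \<le> d / 2" for x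
    using d(2)[of x] that \<open>d > 0\<close> linear_0[OF \<open>linear f\<close>] by simp
  then have "norm (f x) \<le> 1 / (d / 2) * norm x" for x
    using linear_norm_bound[OF \<open>linear f\<close>, of "d / 2" 1] \<open>d > 0\<close> by simp
  then show ?thesis
    using \<open>linear f\<close>
    by (intro bounded_linear_intro[where K = "1 / (d / 2)"])
       (simp_all add: linear_add linear_cmul mult.commute)
qed

text \<open>
  With \<open>w = (\<lambda>_. 1)\<close> this is the Banach--Steinhaus theorem. For a separately continuous multilinear
  map, the index \<open>i\<close> collects all arguments but one and \<open>w i\<close> is the product of their norms.
\<close>

lemma weighted_uniform_boundedness:
  fixes f :: "'i \<Rightarrow> 'a::banach \<Rightarrow> 'b::real_normed_vector"
  assumes f: "\<And>i. bounded_linear (f i)"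
    and nonneg: "\<And>i. 0 \<le> w i"
    and pointwise: "\<And>x. \<exists>M. \<forall>i. norm (f i x) \<le> M * w i"
  shows "\<exists>M. \<forall>i x. norm (f i x) \<le> M * w i * norm x"
proof -
  \<comment> \<open>Baire category: these closed sets sort the points by an integer bound for the
    pointwise constant, and they cover the space.\<close>
  define A where "A n = {x. \<forall>i. norm (f i x) \<le> real n * w i}" for n
  have closed: "closed (A n)" for n
  proof -
    have "A n = (\<Inter>i. {x. norm (f i x) \<le> real n * w i})"
      by (auto simp: A_def)
    moreover have "closed {x. norm (f i x) \<le> real n * w i}" for i
      by (intro closed_Collect_le continuous_intros linear_continuous_on f)
    ultimately show ?thesis by auto
  qed
  have "x \<in> \<Union>(range A)" for x
  proof -
    obtain M where M: "\<And>i. norm (f i x) \<le> M * w i"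
      using pointwise by blast
    obtain n :: nat where "M \<le> real n"
      using real_arch_simple by blast
    then have "norm (f i x) \<le> real n * w i" for i
      using M[of i] nonneg[of i] by (meson mult_right_mono order_trans)
    then show ?thesis by (auto simp: A_def)
  qed
  then have "\<Union>(range A) = UNIV" by auto
  then obtain n where "interior (A n) \<noteq> {}"
    using Baire_category_alt[of "euclidean :: 'a topology" "range A"] closed
    by (force simp: completely_metrizable_space_euclidean)
  then obtain x0 e where "e > 0" and e: "cball x0 e \<subseteq> A n"
    by (meson ex_in_conv mem_interior_cball)
  \<comment> \<open>Moving the ball from \<open>x0\<close> to the origin costs the factor 2.\<close>
  have "norm (f i x) \<le> 2 * real n * w i" if "norm x \<le> e" for i x
  proof -
    have "x0 + x \<in> A n" "x0 \<in> A n"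
      using e that \<open>e > 0\<close> by (auto simp: dist_norm subset_eq)
    then have "norm (f i (x0 + x)) \<le> real n * w i" "norm (f i x0) \<le> real n * w i"
      by (simp_all add: A_def)
    moreover have "f i x = f i (x0 + x) - f i x0"
      using f by (simp add: bounded_linear.linear linear_add)
    ultimately show ?thesis
      using norm_triangle_ineq4[of "f i (x0 + x)" "f i x0"] by simp
  qed
  then have "norm (f i x) \<le> (2 * real n * w i) / e * norm x" for i x
    using linear_norm_bound[OF bounded_linear.linear[OF f] \<open>e > 0\<close>] by blast
  then have "norm (f i x) \<le> (2 * real n / e) * w i * norm x" for i x
    by simp
  then show ?thesis by blast
qed

section \<open>Defects on triple products\<close>

lemma mult_norm_le:
  fixes x y :: "'a::real_normed_algebra"
  assumes "norm x \<le> p" and "norm y \<le> q"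
  shows "norm (x * y) \<le> p * q"
  using assms by (meson mult_mono norm_ge_zero norm_mult_ineq order_trans)

lemma triple_defect_bound:
  fixes T :: "'a::{real_normed_algebra,banach} \<Rightarrow> 'b::real_normed_algebra"
  assumes T: "linear T"
    and \<epsilon>: "\<And>a b. norm (T (a * b) - T a * T b) \<le> \<epsilon> * norm a * norm b" "\<epsilon> \<ge> 0"
  shows "\<exists>C. \<forall>a b c. norm (T (a * b * c) - T a * T b * T c) \<le> C * norm a * norm b * norm c"
proof -
  define \<beta> where "\<beta> a b = T (a * b) - T a * T b" for a b
  have \<beta>: "norm (\<beta> a b) \<le> \<epsilon> * norm a * norm b" for a b
    using \<epsilon> by (simp add: \<beta>_def)
  have \<beta>1: "norm (\<beta> (a * b) c) \<le> \<epsilon> * norm a * norm b * norm c" for a b c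
  proof -
    have "\<epsilon> * norm (a * b) * norm c \<le> \<epsilon> * (norm a * norm b) * norm c"
      using \<epsilon>(2) by (intro mult_right_mono mult_left_mono norm_mult_ineq) auto
    then show ?thesis using \<beta>[of "a * b" c] by (simp add: mult.assoc)
  qed
  have \<beta>2: "norm (\<beta> a (b * c)) \<le> \<epsilon> * norm a * norm b * norm c" for a b c
  proof -
    have "\<epsilon> * norm a * norm (b * c) \<le> \<epsilon> * norm a * (norm b * norm c)"
      using \<epsilon>(2) by (intro mult_left_mono norm_mult_ineq) auto
    then show ?thesis using \<beta>[of a "b * c"] by (simp add: mult.assoc)
  qed
  \<comment> \<open>By associativity both \<open>T (a * b * c)\<close> and
    \<open>T a * T b * T c\<close> cancel.\<close>
  have cocycle: "\<beta> a b * T c = T a * \<beta> b c - \<beta> (a * b) c + \<beta> a (b * c)" for a b c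
    by (simp add: \<beta>_def algebra_simps)
  \<comment> \<open>The possibly unbounded factor \<open>norm (T a)\<close> is harmless here, since
    \<open>a\<close> is fixed.\<close>
  have "bounded_linear (\<lambda>c. \<beta> a b * T c)" for a b
  proof (rule bounded_linear_intro)
    fix c
    have "norm (T a * \<beta> b c) \<le> norm (T a) * (\<epsilon> * norm b * norm c)"
      by (intro mult_norm_le \<beta> order_refl)
    then have "norm (\<beta> a b * T c) \<le> norm (T a) * (\<epsilon> * norm b * norm c)
        + \<epsilon> * norm a * norm b * norm c + \<epsilon> * norm a * norm b * norm c"
      unfolding cocycle using \<beta>1 \<beta>2
      by (meson add_mono norm_triangle_le norm_triangle_le_diff)
    then show "norm (\<beta> a b * T c)
        \<le> norm c * (norm (T a) * \<epsilon> * norm b + \<epsilon> * norm a * norm b + \<epsilon> * norm a * norm b)"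
      by (simp add: algebra_simps)
  qed (simp_all add: linear_add[OF T] linear_cmul[OF T] distrib_left)
  moreover have "\<exists>M. \<forall>i. norm (\<beta> (fst i) (snd i) * T c) \<le> M * (norm (fst i) * norm (snd i))" for c
    using mult_norm_le[OF \<beta> order_refl, of _ _ "T c"]
    by (intro exI[of _ "\<epsilon> * norm (T c)"]) (simp add: mult_ac)
  ultimately obtain M where
    "\<And>a b c. norm (\<beta> a b * T c) \<le> M * (norm a * norm b) * norm c"
    using weighted_uniform_boundedness[of "\<lambda>i c. \<beta> (fst i) (snd i) * T c"
        "\<lambda>i. norm (fst i) * norm (snd i)"] by auto
  then have M: "norm (\<beta> a b * T c) \<le> M * norm a * norm b * norm c" for a b c
    by (simp add: mult.assoc)
  have "norm (T (a * b * c) - T a * T b * T c) \<le> (\<epsilon> + M) * norm a * norm b * norm c" for a b c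
  proof -
    have "T (a * b * c) - T a * T b * T c = \<beta> (a * b) c + \<beta> a b * T c"
      by (simp add: \<beta>_def algebra_simps)
    then show ?thesis
      using norm_triangle_mono[OF \<beta>1[of a b c] M[of a b c]] by (simp add: algebra_simps)
  qed
  then show ?thesis by blast
qed

text \<open>Each summand in \<open>M\<close> is evidently bounded in the argument of
  \<open>E\<close>; boundedness of the sum transfers to it the bound of the other summand in the
  remaining argument.\<close>

lemma sandwich_bound:
  fixes T E :: "'a::{real_normed_algebra,banach} \<Rightarrow> 'b::real_normed_algebra"
  assumes T: "linear T" and E: "bounded_linear E"
    and M: "\<And>a b. norm (T a * E b + E a * T b) \<le> M * norm a * norm b"
  shows "\<exists>C. \<forall>a b c. norm (T a * E b * T c) \<le> C * norm a * norm b * norm c"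
proof -
  obtain K where K: "\<And>x. norm (E x) \<le> K * norm x"
    using bounded_linear.bounded[OF E] by (auto simp: mult.commute)
  have "bounded_linear (\<lambda>a. T a * E b)" for b
  proof (rule bounded_linear_intro)
    fix a
    have "norm (E a * T b) \<le> K * norm a * norm (T b)"
      by (intro mult_norm_le K order_refl)
    then have "norm (T a * E b) \<le> M * norm a * norm b + K * norm a * norm (T b)"
      using M[of a b] norm_triangle_ineq4[of "T a * E b + E a * T b" "E a * T b"] by simp
    then show "norm (T a * E b) \<le> norm a * (M * norm b + K * norm (T b))"
      by (simp add: algebra_simps)
  qed (simp_all add: linear_add[OF T] linear_cmul[OF T] distrib_right)
  moreover have "\<exists>L. \<forall>b. norm (T a * E b) \<le> L * norm b" for a
    using mult_norm_le[OF order_refl K, of "T a"]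
    by (intro exI[of _ "norm (T a) * K"]) (simp add: mult_ac)
  ultimately obtain L where "\<And>b a. norm (T a * E b) \<le> L * norm b * norm a"
    using weighted_uniform_boundedness[of "\<lambda>b a. T a * E b" norm] by auto
  then have L: "norm (T a * E b) \<le> L * norm a * norm b" for a b
    by (simp add: mult_ac)
  have N: "norm (E a * T b) \<le> (M + L) * norm a * norm b" for a b
    using M[of a b] L[of a b] norm_triangle_ineq4[of "T a * E b + E a * T b" "T a * E b"]
    by (simp add: algebra_simps)
  \<comment> \<open>For fixed \<open>b\<close>, \<open>c\<close> group as
    \<open>(T a * E b) * T c\<close> and use \<open>L\<close>; for fixed \<open>a\<close> group as
    \<open>T a * (E b * T c)\<close> and use \<open>N\<close>.\<close>
  have "bounded_linear (\<lambda>a. T a * E b * T c)" for b c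
  proof (rule bounded_linear_intro)
    fix a
    show "norm (T a * E b * T c) \<le> norm a * (L * norm b * norm (T c))"
      using mult_norm_le[OF L order_refl, of a b "T c"] by (simp add: mult_ac)
  qed (simp_all add: linear_add[OF T] linear_cmul[OF T] distrib_right)
  moreover have "\<exists>C. \<forall>i. norm (T a * E (fst i) * T (snd i)) \<le> C * (norm (fst i) * norm (snd i))"
    for a
    using mult_norm_le[OF order_refl N, of "T a"]
    by (intro exI[of _ "norm (T a) * (M + L)"]) (simp add: mult.assoc)
  ultimately obtain C where
    "\<And>b c a. norm (T a * E b * T c) \<le> C * (norm b * norm c) * norm a"
    using weighted_uniform_boundedness[of "\<lambda>i a. T a * E (fst i) * T (snd i)"
        "\<lambda>i. norm (fst i) * norm (snd i)"] by auto
  then show ?thesis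
    by (intro exI[of _ C]) (simp add: mult_ac)
qed

section \<open>Generalised homomorphisms\<close>

text \<open>For nonzero \<open>r\<close>, cancel \<open>r\<close> in \<open>mult_conjugate\<close>;
  additivity settles zero. This makes the conjugate-linear involutions real-linear.\<close>

lemma conjugate_of_real: "conjugate (of_real r :: 'k::real_or_complex) = of_real r"
proof (cases "r = 0")
  case True
  have "conjugate (0 + 0 :: 'k) = conjugate 0 + conjugate 0"
    by (rule conjugate_add)
  then show ?thesis using True by simp
next
  case False
  have "(of_real r :: 'k) * conjugate (of_real r) = of_real r * of_real r"
    using mult_conjugate[of "of_real r :: 'k"]
    by (simp add: scaleR_conv_of_real power2_eq_square flip: of_real_mult)
  then show ?thesis using False by simp
qed

text \<open>The boundedness arguments run over the reals, whatever the scalar field.\<close>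

lemma real_linear_if_linear:
  assumes "banach_algebra scaleA" and "banach_algebra scaleB"
    and "Vector_Spaces.linear scaleA scaleB T"
  shows "linear T"
proof -
  interpret A: banach_algebra scaleA by fact
  interpret B: banach_algebra scaleB by fact
  have "T (r *\<^sub>R x) = r *\<^sub>R T x" for r x
    using assms(3) by (simp add: Vector_Spaces.linear_iff
        flip: A.scale_of_real B.scale_of_real)
  then show ?thesis
    using assms(3) by (intro linearI) (simp_all add: Vector_Spaces.linear_iff)
qed

lemma (in banach_star_algebra) bounded_linear_star: "bounded_linear star"
proof (rule bounded_linear_if_continuous[OF _ continuous_star])
  show "linear star"
  proof (rule linearI)
    show "star (r *\<^sub>R x) = r *\<^sub>R star x" for r x
      using star_scale[of "of_real r" x] by (simp add: conjugate_of_real scale_of_real)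
  qed (rule star_add)
qed

text \<open>The definition wants a positive constant; \<open>max 1 C\<close> provides one for
  \<open>C\<close> of any sign.\<close>

lemma generalised_triple_homI:
  assumes "Vector_Spaces.linear scaleE scaleF T"
    and C: "\<And>a b c. norm (T (tripleE a b c) - tripleF (T a) (T b) (T c))
              \<le> C * norm a * norm b * norm c"
  shows "generalised_triple_hom scaleE tripleE scaleF tripleF T"
proof -
  have "C * norm a * norm b * norm c \<le> max 1 C * norm a * norm b * norm c" for a b c
    by (intro mult_right_mono) auto
  then have "norm (T (tripleE a b c) - tripleF (T a) (T b) (T c))
      \<le> max 1 C * norm a * norm b * norm c" for a b c
    using C order_trans by blast
  then show ?thesis
    unfolding generalised_triple_hom_def using assms(1)
    by (intro conjI exI[of _ "max 1 C"]) auto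
qed

text \<open>The bound is invariant under exchanging \<open>a\<close> and \<open>c\<close>, so
  averaging keeps the constant. Abstract \<open>p\<close> and \<open>q\<close> cover both triple
  products.\<close>

lemma symmetrised_defect_bound:
  fixes T :: "'a::real_normed_vector \<Rightarrow> 'b::real_normed_vector"
  assumes T: "linear T"
    and C: "\<And>a b c. norm (T (p a b c) - q a b c) \<le> C * norm a * norm b * norm c"
  shows "norm (T ((1 / 2) *\<^sub>R (p a b c + p c b a)) - (1 / 2) *\<^sub>R (q a b c + q c b a))
    \<le> C * norm a * norm b * norm c"
proof -
  have "T ((1 / 2) *\<^sub>R (p a b c + p c b a)) - (1 / 2) *\<^sub>R (q a b c + q c b a)
      = (1 / 2) *\<^sub>R ((T (p a b c) - q a b c) + (T (p c b a) - q c b a))"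
    by (simp add: linear_add[OF T] linear_cmul[OF T] algebra_simps)
  then show ?thesis
    using norm_triangle_mono[OF C[of a b c] C[of c b a]] by (simp add: mult_ac)
qed

lemma generalised_hom_triple:
  assumes A: "banach_algebra scaleA" and B: "banach_algebra scaleB"
    and hom: "generalised_hom scaleA scaleB T"
  shows "generalised_triple_hom scaleA algebra_triple scaleB algebra_triple T"
proof -
  have lin: "Vector_Spaces.linear scaleA scaleB T"
    using hom by (simp add: generalised_hom_def)
  then have T: "linear T"
    using A B by (rule real_linear_if_linear[rotated 2])
  obtain \<epsilon> where "\<epsilon> > 0" "\<And>a b. norm (T (a * b) - T a * T b) \<le> \<epsilon> * norm a * norm b"
    using hom by (auto simp: generalised_hom_def)
  then obtain C where
    "\<And>a b c. norm (T (a * b * c) - T a * T b * T c) \<le> C * norm a * norm b * norm c"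
    using triple_defect_bound[OF T, of \<epsilon>] by auto
  then show ?thesis
    unfolding algebra_triple_def
    by (intro generalised_triple_homI[OF lin] symmetrised_defect_bound[OF T])
qed

lemma generalised_star_hom_triple:
  fixes T :: "'a::{real_normed_algebra,banach} \<Rightarrow> 'b::{real_normed_algebra,banach}"
  assumes A: "banach_star_algebra scaleA starA" and B: "banach_star_algebra scaleB starB"
    and hom: "generalised_star_hom scaleA starA scaleB starB T"
  shows "generalised_triple_hom scaleA (star_triple starA) scaleB (star_triple starB) T"
proof -
  interpret A: banach_star_algebra scaleA starA by fact
  interpret B: banach_star_algebra scaleB starB by fact
  have lin: "Vector_Spaces.linear scaleA scaleB T"
    using hom by (simp add: generalised_star_hom_def generalised_hom_def)
  then have T: "linear T"
    using A.banach_algebra_axioms B.banach_algebra_axioms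
    by (rule real_linear_if_linear[rotated 2])
  obtain \<epsilon> where \<epsilon>: "\<epsilon> > 0" "\<And>a b. norm (T (a * b) - T a * T b) \<le> \<epsilon> * norm a * norm b"
    using hom by (auto simp: generalised_star_hom_def generalised_hom_def)
  then obtain C where
    C: "\<And>a b c. norm (T (a * b * c) - T a * T b * T c) \<le> C * norm a * norm b * norm c"
    using triple_defect_bound[OF T, of \<epsilon>] by auto
  obtain P where P: "P \<ge> 0" "\<And>x. norm (starA x) \<le> P * norm x"
    using bounded_linear.nonneg_bounded[OF A.bounded_linear_star] by (auto simp: mult.commute)
  obtain Q where Q: "Q \<ge> 0" "\<And>x. norm (starB x) \<le> Q * norm x"
    using bounded_linear.nonneg_bounded[OF B.bounded_linear_star] by (auto simp: mult.commute)
  have starA: "linear starA" and starB: "linear starB"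
    using A.bounded_linear_star B.bounded_linear_star by (auto intro: bounded_linear.linear)

  \<comment> \<open>The sign is opposite to that in \<open>generalised_star_hom\<close>, hence the
    negation below.\<close>
  define E where "E b = T b - starB (T (starA b))" for b
  have "continuous_on UNIV (\<lambda>b. - (starB (T (starA b)) - T b))"
    using hom by (intro continuous_on_minus) (simp add: generalised_star_hom_def)
  then have "continuous_on UNIV E"
    by (simp add: E_def[abs_def])
  moreover have "linear E"
    by (rule linearI)
      (simp_all add: E_def linear_add[OF T] linear_cmul[OF T] linear_add[OF starA]
        linear_cmul[OF starA] linear_add[OF starB] linear_cmul[OF starB] algebra_simps)
  ultimately have E: "bounded_linear E"
    by (rule bounded_linear_if_continuous[rotated])
  obtain K where K: "K \<ge> 0" "\<And>x. norm (E x) \<le> K * norm x"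
    using bounded_linear.nonneg_bounded[OF E] by (auto simp: mult.commute)

  \<comment> \<open>The four constants bound, in order, the four terms of the identity below. That
    identity comes from expanding \<open>(T a - E a) * (T b - E b)\<close>, the product of the maps
    \<open>x \<mapsto> starB (T (starA x))\<close> at \<open>a\<close> and \<open>b\<close>;
    \<open>\<beta>\<close> is the multiplicative defect at \<open>starA b\<close>,
    \<open>starA a\<close>, in the order reversed by the involution.\<close>
  have "norm (T a * E b + E a * T b) \<le> (K + K * K + \<epsilon> + Q * \<epsilon> * P * P) * norm a * norm b" for a b
  proof -
    define \<beta> where "\<beta> = T (starA b * starA a) - T (starA b) * T (starA a)"
    have "T a * E b + E a * T b
        = E (a * b) + E a * E b - (T (a * b) - T a * T b) + starB \<beta>"
      unfolding E_def \<beta>_def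
      by (simp add: A.star_mult B.star_mult linear_diff[OF starB] algebra_simps)
    moreover have "norm (E (a * b)) \<le> K * (norm a * norm b)"
      using K(1) by (intro order_trans[OF K(2)] mult_left_mono norm_mult_ineq)
    moreover have "norm (E a * E b) \<le> (K * norm a) * (K * norm b)"
      by (intro mult_norm_le K(2))
    moreover have "norm (starB \<beta>) \<le> Q * (\<epsilon> * (P * norm a) * (P * norm b))"
    proof -
      have "norm \<beta> \<le> \<epsilon> * norm (starA b) * norm (starA a)"
        unfolding \<beta>_def by (rule \<epsilon>(2))
      also have "\<dots> \<le> \<epsilon> * (P * norm b) * (P * norm a)"
        using \<epsilon>(1) P by (intro mult_mono) auto
      finally have "norm \<beta> \<le> \<epsilon> * (P * norm a) * (P * norm b)"
        by (simp add: mult_ac)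
      then show ?thesis
        using Q(1) by (intro order_trans[OF Q(2)] mult_left_mono)
    qed
    ultimately have "norm (T a * E b + E a * T b)
        \<le> K * (norm a * norm b) + (K * norm a) * (K * norm b) + \<epsilon> * norm a * norm b
          + Q * (\<epsilon> * (P * norm a) * (P * norm b))"
      using \<epsilon>(2)[of a b] by (smt (verit) norm_triangle_ineq norm_triangle_ineq4)
    then show ?thesis by (simp add: algebra_simps)
  qed
  then obtain D where
    D: "\<And>a b c. norm (T a * E b * T c) \<le> D * norm a * norm b * norm c"
    using sandwich_bound[OF T E] by blast

  \<comment> \<open>Replacing \<open>starB (T b)\<close> by \<open>T (starA b)\<close> costs the
    sandwich term at \<open>starA b\<close>. The factor \<open>P\<close> absorbs
    \<open>starA\<close>; absolute values allow for negative \<open>C\<close> or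
    \<open>D\<close>.\<close>
  have "norm (T (a * starA b * c) - T a * starB (T b) * T c)
      \<le> ((\<bar>C\<bar> + \<bar>D\<bar>) * P) * norm a * norm b * norm c" for a b c
  proof -
    have "T (a * starA b * c) - T a * starB (T b) * T c
        = (T (a * starA b * c) - T a * T (starA b) * T c) + T a * E (starA b) * T c"
      by (simp add: E_def A.star_star algebra_simps)
    then have "norm (T (a * starA b * c) - T a * starB (T b) * T c)
        \<le> C * norm a * norm (starA b) * norm c + D * norm a * norm (starA b) * norm c"
      using norm_triangle_mono[OF C[of a "starA b" c] D[of a "starA b" c]] by (simp only:)
    also have "\<dots> = (C + D) * (norm a * norm (starA b) * norm c)"
      by (simp add: algebra_simps)
    also have "\<dots> \<le> (\<bar>C\<bar> + \<bar>D\<bar>) * (norm a * (P * norm b) * norm c)"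
      using P by (intro mult_mono) auto
    finally show ?thesis by (simp add: mult_ac)
  qed
  then show ?thesis
    unfolding star_triple_def
    by (intro generalised_triple_homI[OF lin]
        symmetrised_defect_bound[OF T, where p = "\<lambda>a b c. a * starA b * c"
          and q = "\<lambda>a b c. T a * starB (T b) * T c"])
qed

theorem proposition1:
  fixes scaleA :: "'k::real_or_complex \<Rightarrow> 'a::{real_normed_algebra,banach} \<Rightarrow> 'a"
    and scaleB :: "'k \<Rightarrow> 'b::{real_normed_algebra,banach} \<Rightarrow> 'b"
    and starA :: "'a \<Rightarrow> 'a" and starB :: "'b \<Rightarrow> 'b"
    and T :: "'a \<Rightarrow> 'b"
  shows "(banach_algebra scaleA \<and> banach_algebra scaleB \<and> generalised_hom scaleA scaleB T
            \<longrightarrow> generalised_triple_hom scaleA algebra_triple scaleB algebra_triple T)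
       \<and> (banach_star_algebra scaleA starA \<and> banach_star_algebra scaleB starB
            \<and> generalised_star_hom scaleA starA scaleB starB T
            \<longrightarrow> generalised_triple_hom scaleA (star_triple starA) scaleB (star_triple starB) T)"
  using generalised_hom_triple generalised_star_hom_triple by blast

end
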